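(* Assume (A1), (A2), (A4). Then for every $\lambda\in S^1$, the map $G(\lambda,\cdot):\ell^2\to\ell^2$, $\mathbf x\mapsto S\mathbf x-(f_n(\lambda,x_n))_n$, is proper on closed bounded subsets of $\ell^2$.
   Context: $\ell^2$ is the Hilbert space of $\mathbb R^d$-valued sequences on $\mathbb Z$ with $\sum|x_n|^2<\infty$; $S\mathbf x=(x_{n+1})$. $f_n:S^1\times\mathbb R^d\to\mathbb R^d$ are $C^1$ with $f_n(\lambda,0)=0$. Proper on closed bounded subsets: the restriction to every closed bounded set has compact preimages of compact sets. (A1) For any $M>0,\varepsilon>0$ there is $\delta\in(0,M)$ with $\sup_n|\partial_x f_n(\lambda_1,x_1)-\partial_x f_n(\lambda_2,x_2)|<\varepsilon$ and $\sup_n|\partial_\lambda f_n(\lambda_1,x_1)-\partial_\lambda f_n(\lambda_2,x_2)|<\varepsilon$ whenever $(\lambda_i,x_i)\in S^1\times\bar B_d(0,M)$ are at distance $<\delta$ ($\partial_\lambda$ in the angle coordinate). (A2) $\partial_x f_n(\lambda,0)\to a(\lambda,\pm\infty)$ as $n\to\pm\infty$ uniformly in $\lambda$, with $a(\lambda,\pm\infty)$ hyperbolic (invertible, no eigenvalue of modulus one) and having the same number of eigenvalues in the open unit disk. (A4) $f_n(\lambda,x)\to f^\infty_\pm(\lambda,x)$ as $n\to\pm\infty$ uniformly for $x$ in bounded subsets of $\mathbb R^d$, and for each $\lambda\in S^1$ the equations $x_{n+1}=f^\infty_+(\lambda,x_n)$ and $x_{n+1}=f^\infty_-(\lambda,x_n)$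 have no nonzero solution $(x_n)\in\ell^2$. *)

theory Defs
  imports "HOL-Analysis.Analysis" "HOL-Computational_Algebra.Polynomial"
begin

definition l2 :: "(int \<Rightarrow> real^'d::finite) set" where
  "l2 = {x. (\<lambda>n. (norm (x n))\<^sup>2) summable_on UNIV}"

definition l2_dist :: "(int \<Rightarrow> real^'d::finite) \<Rightarrow> (int \<Rightarrow> real^'d) \<Rightarrow> real" where
  "l2_dist x y = sqrt (\<Sum>\<^sub>\<infinity>n. (norm (x n - y n))\<^sup>2)"

definition l2_top :: "(int \<Rightarrow> real^'d::finite) topology" where
  "l2_top = Metric_space.mtopology l2 l2_dist"

definition l2_bounded :: "(int \<Rightarrow> real^'d::finite) set \<Rightarrow> bool" where
  "l2_bounded S = Metric_space.mbounded l2 l2_dist S"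

definition proper_on_closed_bounded ::
  "((int \<Rightarrow> real^'d::finite) \<Rightarrow> (int \<Rightarrow> real^'d)) \<Rightarrow> bool" where
  "proper_on_closed_bounded G \<longleftrightarrow>
     (\<forall>B K. closedin l2_top B \<and> l2_bounded B \<and> compactin l2_top K \<longrightarrow>
        compactin l2_top {x \<in> B. G x \<in> K})"

definition cmat :: "real^'d^'d \<Rightarrow> complex^'d^'d" where
  "cmat A = (\<chi> i j. complex_of_real (A $ i $ j))"

definition char_poly_mat :: "real^'d::finite^'d \<Rightarrow> complex poly" where
  "char_poly_mat A = det (\<chi> i j. (if i = j then [:0, 1:] else 0) - [: cmat A $ i $ j :])"

definition hyperbolic :: "real^'d::finite^'d \<Rightarrow> bool" where
  "hyperbolic A \<longleftrightarrow> invertible A \<and>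
     (\<forall>z::complex. cmod z = 1 \<longrightarrow> poly (char_poly_mat A) z \<noteq> 0)"

definition n_stable :: "real^'d::finite^'d \<Rightarrow> nat" where
  "n_stable A = (\<Sum>z\<in>{z. poly (char_poly_mat A) z = 0 \<and> cmod z < 1}. order z (char_poly_mat A))"

end

theory Submission
  imports Defs "HOL-Complex_Analysis.Great_Picard"
    "HOL-Computational_Algebra.Fundamental_Theorem_Algebra"
begin

text \<open>
  Let \<open>x\<^sub>k\<close> be bounded in \<open>\<ell>\<^sup>2\<close> with \<open>G x\<^sub>k \<rightarrow> y\<close>. A subsequence converges pointwise to some
  \<open>z \<in> \<ell>\<^sup>2\<close> with \<open>G z = y\<close>; it remains to exclude loss of mass at \<open>\<plusminus>\<infinity>\<close>. First, \<open>x\<^sub>k(n)\<close> is small for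
  large \<open>\<bar>n\<bar>\<close> uniformly in \<open>k\<close>: otherwise suitable translates of the \<open>x\<^sub>k\<close> converge pointwise to a nonzero
  \<open>\<ell>\<^sup>2\<close> solution of one of the limit equations. Hence near \<open>\<plusminus>\<infinity>\<close> the nonlinearity acts on \<open>x\<^sub>k - z\<close>
  as a small perturbation of \<open>a(\<lambda>, \<plusminus>\<infinity>)\<close>, and \<open>S - a(\<lambda>, \<plusminus>\<infinity>)\<close> is bounded below on \<open>\<ell>\<^sup>2\<close> by
  hyperbolicity, so the tails of \<open>x\<^sub>k - z\<close> converge to \<open>0\<close> in norm.
\<close>

section \<open>Square-summable two-sided sequences and their norm\<close>

definition sq_summable :: "(int \<Rightarrow> 'a::real_normed_vector) \<Rightarrow> bool" where
  "sq_summable x \<longleftrightarrow> (\<lambda>n. (norm (x n))\<^sup>2) summable_on UNIV"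

text \<open>The target is an arbitrary normed space because complex vectors and real sequences of
  norms also occur below. \<open>infsum\<close> is 0 off the summable case, so the value controls
  the terms only together with \<open>sq_summable\<close>.\<close>

definition l2_norm :: "(int \<Rightarrow> 'a::real_normed_vector) \<Rightarrow> real" where
  "l2_norm x = sqrt (\<Sum>\<^sub>\<infinity>n. (norm (x n))\<^sup>2)"

lemma l2_norm_nonneg [simp]: "0 \<le> l2_norm x"
  by (simp add: l2_norm_def infsum_nonneg)

text \<open>The series has nonnegative terms, so it is governed by its finite partial sums. This
  transfers finite inequalities, Minkowski's above all, to sequences on all integers.\<close>

lemma L2_set_le_imp_sq_summable:
  assumes "\<And>F. finite F \<Longrightarrow> L2_set (\<lambda>n. norm (x n)) F \<le> c"
  shows "sq_summable x" "l2_norm x \<le> c"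
proof -
  have c: "0 \<le> c" using assms[of "{}"] by simp
  have *: "(\<Sum>n\<in>F. (norm (x n))\<^sup>2) \<le> c\<^sup>2" if "finite F" for F
    using assms[OF that] c by (simp add: L2_set_def real_le_lsqrt sqrt_le_D)
  show s: "sq_summable x" unfolding sq_summable_def
    by (rule nonneg_bdd_above_summable_on) (auto intro!: bdd_aboveI[of _ "c\<^sup>2"] *)
  have "(\<Sum>\<^sub>\<infinity>n. (norm (x n))\<^sup>2) \<le> c\<^sup>2"
    by (rule infsum_le_finite_sums) (use s * in \<open>auto simp: sq_summable_def\<close>)
  then show "l2_norm x \<le> c" unfolding l2_norm_def using c by (rule real_le_lsqrt[OF _ , rotated])
qed

lemma L2_set_le_l2_norm:
  assumes "sq_summable x"
  shows "L2_set (\<lambda>n. norm (x n)) F \<le> l2_norm x"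
proof (cases "finite F")
  case True
  then show ?thesis unfolding L2_set_def l2_norm_def
    using assms by (intro real_sqrt_le_mono finite_sum_le_infsum) (auto simp: sq_summable_def)
qed simp

lemma norm_le_l2_norm: "sq_summable x \<Longrightarrow> norm (x n) \<le> l2_norm x"
  using L2_set_le_l2_norm[of x "{n}"] by simp

text \<open>Minkowski's inequality on each finite set of indices. Sums, differences, multiples and
  the perturbation estimates below all reduce to this one comparison.\<close>

lemma sq_summable_dominated:
  assumes "sq_summable y" "sq_summable z" "0 \<le> \<alpha>" "0 \<le> \<beta>"
    and le: "\<And>n. norm (x n) \<le> \<alpha> * norm (y n) + \<beta> * norm (z n)"
  shows "sq_summable x" "l2_norm x \<le> \<alpha> * l2_norm y + \<beta> * l2_norm z"
proof -
  have "L2_set (\<lambda>n. norm (x n)) F \<le> \<alpha> * l2_norm y + \<beta> * l2_norm z" for F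
  proof -
    have "L2_set (\<lambda>n. norm (x n)) F \<le> L2_set (\<lambda>n. \<alpha> * norm (y n) + \<beta> * norm (z n)) F"
      by (rule L2_set_mono) (use le in auto)
    also have "\<dots> \<le> L2_set (\<lambda>n. \<alpha> * norm (y n)) F + L2_set (\<lambda>n. \<beta> * norm (z n)) F"
      by (rule L2_set_triangle_ineq)
    also have "\<dots> = \<alpha> * L2_set (\<lambda>n. norm (y n)) F + \<beta> * L2_set (\<lambda>n. norm (z n)) F"
      using assms by (simp add: L2_set_right_distrib)
    also have "\<dots> \<le> \<alpha> * l2_norm y + \<beta> * l2_norm z"
      using assms by (intro add_mono mult_left_mono L2_set_le_l2_norm)
    finally show ?thesis .
  qed
  then show "sq_summable x" "l2_norm x \<le> \<alpha> * l2_norm y + \<beta> * l2_norm z"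
    using L2_set_le_imp_sq_summable by blast+
qed

lemma sq_summable_mono:
  assumes "sq_summable y" "0 \<le> \<alpha>" "\<And>n. norm (x n) \<le> \<alpha> * norm (y n)"
  shows "sq_summable x" "l2_norm x \<le> \<alpha> * l2_norm y"
  using sq_summable_dominated[of y y \<alpha> 0 x] assms by auto

lemma sq_summable_add:
  assumes "sq_summable x" "sq_summable y"
  shows "sq_summable (\<lambda>n. x n + y n)" "l2_norm (\<lambda>n. x n + y n) \<le> l2_norm x + l2_norm y"
  using sq_summable_dominated[of x y 1 1 "\<lambda>n. x n + y n"] assms by (auto simp: norm_triangle_ineq)

lemma sq_summable_diff:
  assumes "sq_summable x" "sq_summable y"
  shows "sq_summable (\<lambda>n. x n - y n)" "l2_norm (\<lambda>n. x n - y n) \<le> l2_norm x + l2_norm y"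
  using sq_summable_dominated[of x y 1 1 "\<lambda>n. x n - y n"] assms by (auto simp: norm_triangle_ineq4)

lemma l2_norm_shift [simp]:
  fixes k :: int
  shows "sq_summable (\<lambda>n. x (n + k)) \<longleftrightarrow> sq_summable x" "l2_norm (\<lambda>n. x (n + k)) = l2_norm x"
proof -
  have bij: "bij_betw (\<lambda>n::int. n + k) UNIV UNIV"
    by (rule bij_betw_byWitness[where f' = "\<lambda>n. n - k"]) auto
  show "sq_summable (\<lambda>n. x (n + k)) \<longleftrightarrow> sq_summable x"
    unfolding sq_summable_def
    using summable_on_reindex_bij_betw[OF bij, of "\<lambda>n. (norm (x n))\<^sup>2"] .
  show "l2_norm (\<lambda>n. x (n + k)) = l2_norm x"
    unfolding l2_norm_def
    using infsum_reindex_bij_betw[OF bij, of "\<lambda>n. (norm (x n))\<^sup>2"] by simp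
qed

lemma sq_summable_finite_support:
  assumes "finite D" "\<And>n. n \<notin> D \<Longrightarrow> x n = 0"
  shows "sq_summable x" "l2_norm x \<le> (\<Sum>n\<in>D. norm (x n))"
proof -
  have "L2_set (\<lambda>n. norm (x n)) F \<le> (\<Sum>n\<in>D. norm (x n))" if "finite F" for F
  proof -
    have "L2_set (\<lambda>n. norm (x n)) F \<le> (\<Sum>n\<in>F. norm (x n))"
      by (rule L2_set_le_sum) auto
    also have "\<dots> = (\<Sum>n\<in>F \<inter> D. norm (x n))"
      using that assms by (intro sum.mono_neutral_right) auto
    also have "\<dots> \<le> (\<Sum>n\<in>D. norm (x n))"
      using assms by (intro sum_mono2) auto
    finally show ?thesis .
  qed
  then show "sq_summable x" "l2_norm x \<le> (\<Sum>n\<in>D. norm (x n))"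
    using L2_set_le_imp_sq_summable by blast+
qed

text \<open>A Fatou-type argument: on a finite set of indices the bound \<open>R\<close> passes to
  the limit, and finite sets determine the norm.\<close>

lemma sq_summable_pointwise_limit:
  assumes lim: "\<And>n. (\<lambda>k::nat. x k n) \<longlonglongrightarrow> z n"
    and x: "\<And>k. sq_summable (x k)" "\<And>k. l2_norm (x k) \<le> R"
  shows "sq_summable z" "l2_norm z \<le> R"
proof -
  have "L2_set (\<lambda>n. norm (z n)) F \<le> R" for F
  proof (rule LIMSEQ_le_const2)
    show "(\<lambda>k. L2_set (\<lambda>n. norm (x k n)) F) \<longlonglongrightarrow> L2_set (\<lambda>n. norm (z n)) F"
      unfolding L2_set_def by (intro tendsto_intros lim)
    show "\<exists>N. \<forall>k\<ge>N. L2_set (\<lambda>n. norm (x k n)) F \<le> R"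
      using x L2_set_le_l2_norm order_trans by blast
  qed
  then show "sq_summable z" "l2_norm z \<le> R"
    using L2_set_le_imp_sq_summable by blast+
qed

text \<open>Chebyshev's argument: \<open>m\<close> indices with value at least \<open>e\<close>
  contribute at least \<open>m\<close> times the square of \<open>e\<close> to the sum.\<close>

lemma sq_summable_finite_large:
  assumes "sq_summable x" "0 < e"
  shows "finite {n. e \<le> norm (x n)}"
proof (rule ccontr)
  assume inf: "infinite {n. e \<le> norm (x n)}"
  obtain m :: nat where m: "(l2_norm x)\<^sup>2 < of_nat m * e\<^sup>2"
    using reals_Archimedean3[of "e\<^sup>2"] assms by (auto simp: mult.commute)
  obtain F where F: "finite F" "card F = m" "F \<subseteq> {n. e \<le> norm (x n)}"
    using infinite_arbitrarily_large[OF inf] by metis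
  have "of_nat m * e\<^sup>2 = (\<Sum>n\<in>F. e\<^sup>2)" using F by simp
  also have "\<dots> \<le> (\<Sum>n\<in>F. (norm (x n))\<^sup>2)"
    using F assms by (intro sum_mono power_mono) auto
  also have "\<dots> = (L2_set (\<lambda>n. norm (x n)) F)\<^sup>2"
    by (simp add: L2_set_def sum_nonneg)
  also have "\<dots> \<le> (l2_norm x)\<^sup>2"
    by (intro power_mono L2_set_le_l2_norm assms) auto
  finally show False using m by simp
qed

text \<open>The sign \<open>s\<close> treats both ends of the integers at once: \<open>s * n\<close>
  tends to plus infinity exactly when \<open>n\<close> runs to the end selected by
  \<open>s\<close>.\<close>

lemma sq_summable_tendsto_0:
  fixes s :: int
  assumes x: "sq_summable x" and s: "s = 1 \<or> s = -1" and n: "filterlim (\<lambda>k. s * n k) at_top F"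
  shows "((\<lambda>k. x (n k)) \<longlongrightarrow> 0) F"
proof (rule tendstoI)
  fix e :: real assume "0 < e"
  then have "finite ((*) s ` {n. e \<le> norm (x n)})" using sq_summable_finite_large[OF x] by auto
  then obtain B where B: "\<And>m. e \<le> norm (x m) \<Longrightarrow> s * m \<le> B"
    by (metis (mono_tags, lifting) bdd_above_finite bdd_above.unfold imageI mem_Collect_eq)
  have "eventually (\<lambda>k. B < s * n k) F"
    using n unfolding filterlim_at_top by (auto elim!: allE[of _ "B + 1"] eventually_mono)
  then show "eventually (\<lambda>k. dist (x (n k)) 0 < e) F"
    by (rule eventually_mono) (metis B dist_0_norm dist_commute not_less)
qed

section \<open>Matrix norms and polynomials in a matrix\<close>

lemma norm_matrix_vector_mult_le:
  fixes A :: "'a::real_normed_field^'n^'m"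
  shows "norm (A *v x) \<le> norm A * norm x"
proof -
  have *: "norm ((A *v x) $ i) \<le> norm (A $ i) * norm x" for i
  proof -
    have "norm ((A *v x) $ i) \<le> (\<Sum>j\<in>UNIV. norm (A $ i $ j) * norm (x $ j))"
      unfolding matrix_vector_mult_def by (simp add: norm_mult[symmetric] norm_sum)
    \<comment> \<open>Cauchy-Schwarz in each row; \<open>norm A\<close> is the Frobenius
      norm.\<close>
    also have "\<dots> \<le> norm (A $ i) * norm x"
      unfolding norm_vec_def
      using L2_set_mult_ineq[of "\<lambda>j. norm (A $ i $ j)" "\<lambda>j. norm (x $ j)" UNIV] by simp
    finally show ?thesis .
  qed
  have "norm (A *v x) = L2_set (\<lambda>i. norm ((A *v x) $ i)) UNIV" by (simp add: norm_vec_def)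
  also have "\<dots> \<le> L2_set (\<lambda>i. norm (A $ i) * norm x) UNIV"
    by (rule L2_set_mono) (use * in auto)
  also have "\<dots> = norm A * norm x"
    by (simp add: L2_set_left_distrib[symmetric] norm_vec_def[of A])
  finally show ?thesis .
qed

text \<open>The vector \<open>p(A) v\<close>, written with iterates of the map
  \<open>v \<mapsto> A v\<close> so that no powers of matrices have to be formed.\<close>

definition poly_apply :: "'a::field poly \<Rightarrow> 'a^'n^'n \<Rightarrow> 'a^'n \<Rightarrow> 'a^'n" where
  "poly_apply p A v = (\<Sum>i\<le>degree p. coeff p i *s (((*v) A) ^^ i) v)"

text \<open>Allowing any upper bound for the degree lets polynomials of different degrees be
  compared over one range of summation.\<close>

lemma poly_apply_eq_sum:
  assumes "degree p \<le> N"
  shows "poly_apply p A v = (\<Sum>i\<le>N. coeff p i *s (((*v) A) ^^ i) v)"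
  unfolding poly_apply_def
  by (rule sum.mono_neutral_left) (use assms in \<open>auto simp: coeff_eq_0\<close>)

lemma poly_apply_add: "poly_apply (p + q) A v = poly_apply p A v + poly_apply q A v"
  using poly_apply_eq_sum[of p "max (degree p) (degree q)" A v]
    poly_apply_eq_sum[of q "max (degree p) (degree q)" A v]
    poly_apply_eq_sum[of "p + q" "max (degree p) (degree q)" A v] degree_add_le_max[of p q]
  by (simp add: vector_sadd_rdistrib sum.distrib)

lemma poly_apply_smult: "poly_apply (smult c p) A v = c *s poly_apply p A v"
  using poly_apply_eq_sum[of "smult c p" "degree p" A v] degree_smult_le[of c p]
  by (simp add: poly_apply_def vec.scale_sum_right)

lemma poly_apply_pCons_0: "poly_apply (pCons 0 p) A v = poly_apply p A (A *v v)"
  using poly_apply_eq_sum[of "pCons 0 p" "Suc (degree p)" A v] degree_pCons_le[of 0 p]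
  by (simp add: poly_apply_def sum.atMost_Suc_shift funpow_swap1 del: sum.atMost_Suc funpow.simps(2))
     (simp add: funpow_Suc_right del: funpow.simps(2))

lemma funpow_matrix_vector_diff_scale:
  fixes A :: "'a::field^'n^'n"
  shows "(((*v) A) ^^ i) (u - c *s v) = (((*v) A) ^^ i) u - c *s (((*v) A) ^^ i) v"
  by (induction i) (auto simp: matrix_vector_mult_diff_distrib vector_scalar_commute)

lemma poly_apply_diff_scale:
  "poly_apply p A (u - c *s v) = poly_apply p A u - c *s poly_apply p A v"
  by (simp add: poly_apply_def funpow_matrix_vector_diff_scale vector_ssub_ldistrib sum_subtractf
      vec.scale_sum_right mult.commute)

text \<open>For splitting off a root: if \<open>(X - c) p\<close> annihilates \<open>v\<close>, then
  \<open>p\<close> annihilates \<open>A v - c v\<close>.\<close>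

lemma poly_apply_linear_factor:
  "poly_apply ([:- c, 1:] * p) A v = poly_apply p A (A *v v - c *s v)"
proof -
  have "[:- c, 1:] * p = smult (- c) p + pCons 0 p" by simp
  then show ?thesis
    by (simp only: poly_apply_add poly_apply_smult poly_apply_pCons_0 poly_apply_diff_scale) simp
qed

lemma poly_apply_commute: "A *v poly_apply p A v = poly_apply p A (A *v v)"
proof -
  have sum: "A *v (\<Sum>i\<in>I. g i) = (\<Sum>i\<in>I. A *v g i)" for I :: "nat set" and g
    by (induction I rule: infinite_finite_induct) (auto simp: matrix_vector_right_distrib)
  show ?thesis
    unfolding poly_apply_def sum by (simp add: vector_scalar_commute funpow_swap1)
qed

section \<open>Lower bounds for the difference operator \<open>S - B\<close>\<close>

lemma norm_vector_smult:
  fixes x :: "'a::real_normed_field^'n"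
  shows "norm (c *s x) = norm c * norm x"
  by (simp add: norm_vec_def L2_set_right_distrib norm_mult)

text \<open>The shift is an isometry, so \<open>S w\<close> and \<open>c w\<close> have norms
  \<open>l2_norm w\<close> and \<open>norm c * l2_norm w\<close>; the norm of their difference is at
  least the gap between these.\<close>

lemma scalar_difference_bound:
  fixes w :: "int \<Rightarrow> 'a::real_normed_field^'n"
  assumes w: "sq_summable w" and c: "norm c \<noteq> 1"
  shows "l2_norm w \<le> 1 / \<bar>1 - norm c\<bar> * l2_norm (\<lambda>n. w (n + 1) - c *s w n)"
proof -
  let ?d = "\<lambda>n. w (n + 1) - c *s w n"
  have cw: "sq_summable (\<lambda>n. c *s w n)"
    by (rule sq_summable_mono(1)[OF w, of "norm c"]) (auto simp: norm_vector_smult)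
  have ws: "sq_summable (\<lambda>n. w (n + 1))" using w by simp
  have d: "sq_summable ?d" by (rule sq_summable_diff[OF ws cw])
  have 1: "l2_norm (\<lambda>n. w (n + 1)) \<le> 1 * l2_norm ?d + norm c * l2_norm w"
  proof (rule sq_summable_dominated[OF d w])
    fix n show "norm (w (n + 1)) \<le> 1 * norm (?d n) + norm c * norm (w n)"
      using norm_triangle_ineq[of "?d n" "c *s w n"] by (simp add: norm_vector_smult)
  qed auto
  have 2: "l2_norm (\<lambda>n. c *s w n) \<le> 1 * l2_norm ?d + 1 * l2_norm (\<lambda>n. w (n + 1))"
  proof (rule sq_summable_dominated[OF d ws])
    fix n show "norm (c *s w n) \<le> 1 * norm (?d n) + 1 * norm (w (n + 1))"
      using norm_triangle_ineq4[of "w (n + 1)" "?d n"] by simp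
  qed auto
  have 3: "l2_norm (\<lambda>n. c *s w n) = norm c * l2_norm w"
    by (simp add: l2_norm_def norm_vector_smult power_mult_distrib infsum_cmult_right' real_sqrt_mult)
  \<comment> \<open>Fact \<open>1\<close> settles \<open>norm c < 1\<close>, fact \<open>2\<close>
    settles \<open>norm c > 1\<close>.\<close>
  have "\<bar>1 - norm c\<bar> * l2_norm w \<le> l2_norm ?d"
    using 1 2 unfolding 3 l2_norm_shift by (auto simp: abs_if algebra_simps)
  then show ?thesis using c by (simp add: field_simps)
qed

text \<open>Peel off the roots \<open>\<mu>\<close> of \<open>p\<close> one at a time: \<open>B - \<mu>\<close> is injective if \<open>\<mu>\<close> lies on the unit
  circle, and otherwise \<open>(B - \<mu>) w = (S - \<mu>) w - (S - B) w\<close>, where \<open>S - \<mu>\<close> is bounded below since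
  the shift \<open>S\<close> is an isometry.\<close>

lemma difference_operator_bound_poly:
  fixes B :: "complex^'n^'n"
  assumes "p \<noteq> 0" and inj: "\<And>z w. norm z = 1 \<Longrightarrow> B *v w = z *s w \<Longrightarrow> w = 0"
  shows "\<exists>C\<ge>0. \<forall>w. sq_summable w \<longrightarrow> (\<forall>n. poly_apply p B (w n) = 0) \<longrightarrow>
           l2_norm w \<le> C * l2_norm (\<lambda>n. w (n + 1) - B *v w n)"
  using \<open>p \<noteq> 0\<close>
proof (induction "degree p" arbitrary: p)
  case 0
  \<comment> \<open>A nonzero constant annihilates only the zero vector, so \<open>w\<close>
    vanishes and the bound holds with constant 0.\<close>
  then obtain c where c: "p = [:c:]" "c \<noteq> 0" by (metis degree_eq_zeroE pCons_0_0)
  have "l2_norm w = 0" if "\<forall>n. poly_apply p B (w n) = 0" for w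
    using that c by (simp add: poly_apply_def l2_norm_def)
  then show ?case by (intro exI[of _ 0]) simp
next
  case (Suc m)
  have "\<not> constant (poly p)" using Suc.hyps(2) by (simp add: constant_degree)
  then obtain \<mu> where "poly p \<mu> = 0" using fundamental_theorem_of_algebra by blast
  then obtain q where q: "p = [:- \<mu>, 1:] * q" by (metis poly_eq_0_iff_dvd dvdE)
  have q0: "q \<noteq> 0" using q Suc.prems by auto
  then have "degree p = Suc (degree q)" by (simp add: q degree_mult_eq del: mult_pCons_left)
  then obtain C where "0 \<le> C" and C: "\<And>w. sq_summable w \<Longrightarrow> (\<And>n. poly_apply q B (w n) = 0) \<Longrightarrow>
      l2_norm w \<le> C * l2_norm (\<lambda>n. w (n + 1) - B *v w n)"
    using Suc.hyps(1)[of q] Suc.hyps(2) q0 by auto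
  show ?case
  proof (cases "norm \<mu> = 1")
    case True
    \<comment> \<open>Since \<open>p(B) v = (B - \<mu>) q(B) v\<close>, injectivity of
      \<open>B - \<mu>\<close> makes \<open>q\<close> annihilate whatever \<open>p\<close> does, and
      the constant \<open>C\<close> for \<open>q\<close> carries over.\<close>
    have "poly_apply q B v = 0" if "poly_apply p B v = 0" for v
    proof (rule inj[OF True])
      show "B *v poly_apply q B v = \<mu> *s poly_apply q B v"
        using that unfolding q poly_apply_linear_factor
        by (simp add: poly_apply_diff_scale poly_apply_commute)
    qed
    then show ?thesis using C \<open>0 \<le> C\<close> by (intro exI[of _ C]) auto
  next
    case False
    define K where "K = norm (B - mat \<mu>)"
    \<comment> \<open>With \<open>d = (S - B) w\<close>, the vector \<open>u = (B - \<mu>) w\<close>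
      is annihilated by \<open>q\<close> and satisfies \<open>(S - B) u = (B - \<mu>) d\<close>,
      hence has norm at most \<open>C * K\<close> times that of \<open>d\<close>. Then
      \<open>(S - \<mu>) w = d + u\<close> costs the factor \<open>C * K + 1\<close>, and the scalar
      bound supplies the fraction.\<close>
    define D where "D = 1 / \<bar>1 - norm \<mu>\<bar> * (C * K + 1)"
    have "mat \<mu> *v v = \<mu> *s v" for v :: "complex^'n"
      by (simp add: vec_eq_iff matrix_vector_mult_def mat_def if_distrib[of "\<lambda>t. t * _"] cong: if_cong)
    then have Kmult: "B *v v - \<mu> *s v = (B - mat \<mu>) *v v" for v
      by (simp add: matrix_vector_mult_diff_rdistrib)
    have K: "norm (B *v v - \<mu> *s v) \<le> K * norm v" for v
      unfolding Kmult K_def by (rule norm_matrix_vector_mult_le)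
    have "l2_norm w \<le> D * l2_norm (\<lambda>n. w (n + 1) - B *v w n)"
      if w: "sq_summable w" and p: "\<And>n. poly_apply p B (w n) = 0" for w
    proof -
      let ?d = "\<lambda>n. w (n + 1) - B *v w n"
      define u where "u n = B *v w n - \<mu> *s w n" for n
      have u: "sq_summable u" unfolding u_def
        by (rule sq_summable_mono(1)[OF w, of K]) (use K in \<open>auto simp: K_def\<close>)
      have d: "sq_summable ?d"
      proof (rule sq_summable_diff)
        show "sq_summable (\<lambda>n. B *v w n)"
          by (rule sq_summable_mono(1)[OF w, of "norm B"]) (auto simp: norm_matrix_vector_mult_le)
      qed (use w in simp)
      have "l2_norm u \<le> C * l2_norm (\<lambda>n. u (n + 1) - B *v u n)"
        using C[OF u] p by (simp add: u_def q poly_apply_linear_factor del: mult_pCons_left)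
      also have "\<dots> \<le> C * (K * l2_norm ?d)"
      proof (intro mult_left_mono \<open>0 \<le> C\<close> sq_summable_mono(2)[OF d])
        fix n
        \<comment> \<open>\<open>B - \<mu>\<close> commutes with both \<open>S\<close> and
          \<open>B\<close>.\<close>
        have "u (n + 1) - B *v u n = B *v ?d n - \<mu> *s ?d n"
          by (simp add: u_def matrix_vector_mult_diff_distrib vector_scalar_commute vector_ssub_ldistrib)
        then show "norm (u (n + 1) - B *v u n) \<le> K * norm (?d n)" using K by metis
      qed (simp add: K_def)
      finally have "l2_norm u \<le> C * (K * l2_norm ?d)" .
      moreover have "l2_norm (\<lambda>n. w (n + 1) - \<mu> *s w n) \<le> l2_norm ?d + l2_norm u"
        using sq_summable_add(2)[OF d u] by (simp add: u_def)
      ultimately have "l2_norm (\<lambda>n. w (n + 1) - \<mu> *s w n) \<le> (C * K + 1) * l2_norm ?d"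
        by (simp add: algebra_simps)
      then have "1 / \<bar>1 - norm \<mu>\<bar> * l2_norm (\<lambda>n. w (n + 1) - \<mu> *s w n)
          \<le> 1 / \<bar>1 - norm \<mu>\<bar> * ((C * K + 1) * l2_norm ?d)"
        by (intro mult_left_mono) auto
      then show ?thesis
        using scalar_difference_bound[OF w False] unfolding D_def by (simp add: mult.assoc)
    qed
    moreover have "0 \<le> D" using \<open>0 \<le> C\<close> by (simp add: D_def K_def)
    ultimately show ?thesis by (intro exI[of _ D]) auto
  qed
qed

section \<open>Hyperbolic real matrices and their complexification\<close>

lemma cmat_mult_vector_power:
  fixes A :: "real^'n^'n"
  shows "(((*v) (cmat A)) ^^ i) v = cmat ((((**) A) ^^ i) (mat 1)) *v v"
proof (induction i)
  case 0
  have "cmat (mat 1 :: real^'n^'n) = mat 1" by (simp add: cmat_def mat_def vec_eq_iff)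
  then show ?case by simp
next
  case (Suc i)
  have "cmat (A ** B) = cmat A ** cmat B" for B :: "real^'n^'n"
    by (simp add: cmat_def matrix_matrix_mult_def vec_eq_iff)
  then show ?case by (simp add: Suc matrix_vector_mul_assoc)
qed

text \<open>Dimension count: the \<open>N + 1\<close> powers of \<open>A\<close> up to exponent
  \<open>N\<close> lie in a real space of dimension \<open>N\<close>, so a nontrivial real
  combination of them vanishes. Its coefficients form the polynomial.\<close>

lemma annihilating_polynomial_exists:
  fixes A :: "real^'n^'n"
  obtains p :: "complex poly" where "p \<noteq> 0" "\<And>v. poly_apply p (cmat A) v = 0"
proof -
  define P where "P i = (((**) A) ^^ i) (mat 1)" for i
  define N where "N = DIM(real^'n^'n)"
  have "\<exists>c::nat \<Rightarrow> real. (\<exists>i\<le>N. c i \<noteq> 0) \<and> (\<Sum>i\<le>N. c i *\<^sub>R P i) = 0"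
  \<comment> \<open>\<open>dependent\<close> speaks about sets, in which equal powers would
    collapse; a repetition gives the relation directly, with coefficients 1 and -1.\<close>
  proof (cases "inj_on P {..N}")
    case True
    then have "card (P ` {..N}) > N" by (simp add: card_image)
    then have "dependent (P ` {..N})" unfolding N_def by (intro dependent_biggerset)
    then obtain u i where "u (P i) \<noteq> 0" "i \<le> N" "(\<Sum>v\<in>P ` {..N}. u v *\<^sub>R v) = 0"
      by (auto simp: real_vector.dependent_finite)
    then show ?thesis using sum.reindex[OF True, of "\<lambda>v. u v *\<^sub>R v"]
      by (intro exI[of _ "u \<circ> P"]) auto
  next
    case False
    then obtain i j where ij: "i \<le> N" "j \<le> N" "P i = P j" "i \<noteq> j" by (auto simp: inj_on_def)
    define c where "c k = (if k = i then 1 else 0) - (if k = j then 1 else 0 :: real)" for k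
    have "(\<Sum>k\<le>N. c k *\<^sub>R P k) = (\<Sum>k\<le>N. if k = i then P k else 0) - (\<Sum>k\<le>N. if k = j then P k else 0)"
      unfolding sum_subtractf[symmetric] by (rule sum.cong) (auto simp: c_def)
    also have "\<dots> = 0" using ij by simp
    finally show ?thesis using ij by (intro exI[of _ c]) (auto simp: c_def)
  qed
  then obtain c i where c: "i \<le> N" "c i \<noteq> 0" "(\<Sum>i\<le>N. c i *\<^sub>R P i) = 0" by blast
  define p where "p = (\<Sum>i\<le>N. monom (complex_of_real (c i)) i)"
  have coeff: "coeff p k = (if k \<le> N then of_real (c k) else 0)" for k
    by (simp add: p_def coeff_sum)
  have "p \<noteq> 0" using coeff[of i] c by auto
  moreover have "poly_apply p (cmat A) v = 0" for v
  proof -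
    have "degree p \<le> N" by (rule degree_le) (simp add: coeff)
    then have "poly_apply p (cmat A) v = (\<Sum>i\<le>N. of_real (c i) *s (cmat (P i) *v v))"
      by (simp add: poly_apply_eq_sum coeff cmat_mult_vector_power P_def)
    also have "\<dots> $ k = 0" for k
    proof -
      have "(\<Sum>i\<le>N. of_real (c i) *s (cmat (P i) *v v)) $ k
          = (\<Sum>i\<le>N. \<Sum>j\<in>UNIV. complex_of_real (c i * P i $ k $ j) * v $ j)"
        by (simp add: matrix_vector_mult_def cmat_def sum_distrib_left mult.assoc)
      also have "\<dots> = (\<Sum>j\<in>UNIV. complex_of_real ((\<Sum>i\<le>N. c i *\<^sub>R P i) $ k $ j) * v $ j)"
        by (subst sum.swap) (simp add: sum_distrib_right)
      also have "\<dots> = 0" by (simp add: c)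
      finally show ?thesis .
    qed
    ultimately show ?thesis by (simp add: vec_eq_iff)
  qed
  ultimately show ?thesis using that by blast
qed

lemma poly_det: "poly (det M) z = det (\<chi> i j. poly (M $ i $ j) z)"
  for M :: "complex poly^'n^'n"
  by (simp add: det_def poly_sum poly_prod)

text \<open>Evaluating the characteristic polynomial at \<open>z\<close> gives the determinant of
  \<open>z - A\<close>; if it is nonzero, \<open>z - A\<close> has a left inverse.\<close>

lemma char_poly_mat_nonroot_injective:
  assumes "poly (char_poly_mat A) z \<noteq> 0" and eq: "cmat A *v w = z *s w"
  shows "w = 0"
proof -
  define M where "M = (\<chi> i j. (if i = j then z else 0) - cmat A $ i $ j)"
  have "poly (char_poly_mat A) z = det M"
    unfolding char_poly_mat_def poly_det M_def by (intro arg_cong[of _ _ det]) (auto simp: vec_eq_iff)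
  then obtain M' where M': "M' ** M = mat 1"
    using assms(1) by (metis invertible_det_nz invertible_def)
  have "M *v w = z *s w - cmat A *v w"
    by (simp add: M_def vec_eq_iff matrix_vector_mult_def left_diff_distrib sum_subtractf
        if_distrib[of "\<lambda>t. t * _"] cong: if_cong)
  then have "M' *v (M *v w) = 0" using eq by simp
  then show ?thesis by (simp add: matrix_vector_mul_assoc M')
qed

text \<open>The complex bound applies with a polynomial annihilating every vector, which makes its
  condition on \<open>w\<close> automatic; hyperbolicity excludes eigenvalues on the unit
  circle.\<close>

lemma hyperbolic_difference_operator_bound:
  fixes A :: "real^'n^'n"
  assumes "hyperbolic A"
  obtains C where "0 \<le> C"
    "\<And>v. sq_summable v \<Longrightarrow> l2_norm v \<le> C * l2_norm (\<lambda>n. v (n + 1) - A *v v n)"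
proof -
  obtain p where p: "p \<noteq> 0" "\<And>v. poly_apply p (cmat A) v = 0"
    using annihilating_polynomial_exists by blast
  have "w = 0" if "cmod z = 1" "cmat A *v w = z *s w" for z w
    using assms that char_poly_mat_nonroot_injective unfolding hyperbolic_def by blast
  then obtain C where C: "0 \<le> C" "\<And>w. sq_summable w \<Longrightarrow>
      l2_norm w \<le> C * l2_norm (\<lambda>n. w (n + 1) - cmat A *v w n)"
    using difference_operator_bound_poly[OF p(1), of "cmat A"] p(2) by auto
  \<comment> \<open>The inclusion of real into complex vectors is isometric and intertwines
    \<open>A\<close> with \<open>cmat A\<close>, so the complex bound restricts to real
    sequences.\<close>
  define cv :: "real^'n \<Rightarrow> complex^'n" where "cv x = (\<chi> i. of_real (x $ i))" for x
  have norm_cv: "norm (cv x) = norm x" for x by (simp add: norm_vec_def cv_def)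
  have cv: "cv x - cmat A *v cv y = cv (x - A *v y)" for x y
    by (simp add: cv_def cmat_def matrix_vector_mult_def vec_eq_iff)
  show ?thesis
  proof (rule that[OF C(1)])
    fix v :: "int \<Rightarrow> real^'n" assume "sq_summable v"
    then show "l2_norm v \<le> C * l2_norm (\<lambda>n. v (n + 1) - A *v v n)"
      using C(2)[of "\<lambda>n. cv (v n)"] by (simp add: sq_summable_def l2_norm_def norm_cv cv)
  qed
qed

section \<open>Behaviour of the sequences near one end of the integers\<close>

lemma tails_uniformly_small:
  fixes s :: int and g :: "int \<Rightarrow> real^'n \<Rightarrow> real^'n" and x :: "nat \<Rightarrow> int \<Rightarrow> real^'n"
  assumes s: "s = 1 \<or> s = -1"
    and cont: "\<And>n. continuous_on UNIV (g n)"
    and lim: "\<And>R \<epsilon>. 0 < \<epsilon> \<Longrightarrow> \<exists>N. \<forall>n. N \<le> s * n \<longrightarrow> (\<forall>x. norm x \<le> R \<longrightarrow> norm (g n x - h x) < \<epsilon>)"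
    and sol: "\<And>z. sq_summable z \<Longrightarrow> (\<forall>n. z (n + 1) = h (z n)) \<Longrightarrow> z = (\<lambda>n. 0)"
    and x: "\<And>k. sq_summable (x k)" "\<And>k. l2_norm (x k) \<le> R"
    and y: "sq_summable y"
    and Gx: "\<And>k. sq_summable (\<lambda>n. x k (n + 1) - g n (x k n) - y n)"
    and conv: "(\<lambda>k. l2_norm (\<lambda>n. x k (n + 1) - g n (x k n) - y n)) \<longlonglongrightarrow> 0"
    and e: "0 < e"
  shows "\<exists>N K. \<forall>k\<ge>K. \<forall>n. N \<le> s * n \<longrightarrow> norm (x k n) < e"
proof (rule ccontr)
  assume "\<not> ?thesis"
  \<comment> \<open>The negated claim, used with both thresholds equal to \<open>j\<close>.\<close>
  then have "\<exists>k n. j \<le> k \<and> int j \<le> s * n \<and> e \<le> norm (x k n)" for j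
    by (meson not_less)
  then obtain \<kappa> \<nu> where \<kappa>: "\<And>j. j \<le> \<kappa> j" and \<nu>: "\<And>j. int j \<le> s * \<nu> j"
    and big: "\<And>j. e \<le> norm (x (\<kappa> j) (\<nu> j))" by metis
  \<comment> \<open>Translate so that the large value sits at index 0, where it survives in the
    limit.\<close>
  define X where "X j m = x (\<kappa> j) (m + \<nu> j)" for j m
  have X: "sq_summable (X j)" "l2_norm (X j) \<le> R" for j
    using l2_norm_shift[of "x (\<kappa> j)" "\<nu> j"] x[of "\<kappa> j"] by (simp_all add: X_def[abs_def])
  have XR: "norm (X j m) \<le> R" for j m
    using norm_le_l2_norm[OF X(1)] X(2) order_trans by blast
  obtain r :: "nat \<Rightarrow> nat" where r: "strict_mono r" and "\<And>m. m \<in> UNIV \<Longrightarrow> \<exists>l. (\<lambda>j. X (r j) m) \<longlonglongrightarrow> l"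
    using function_convergent_subsequence[of UNIV X R] XR by (metis countableI_type)
  then obtain z where z: "\<And>m. (\<lambda>j. X (r j) m) \<longlonglongrightarrow> z m" by (metis UNIV_I)
  have r_top: "filterlim r at_top sequentially" using r by (rule filterlim_subseq)
  have z_sq: "sq_summable z"
    using sq_summable_pointwise_limit(1)[of "\<lambda>j. X (r j)" z R] z X by blast
  have zR: "norm (z m) \<le> R" for m
    by (rule LIMSEQ_le_const2[OF tendsto_norm[OF z]]) (use XR in auto)
  \<comment> \<open>\<open>h\<close> is given only as a limit; continuity comes from uniform
    convergence along the indices \<open>n = s * j\<close>.\<close>
  have h_cont: "continuous_on (cball 0 R) h"
  proof (rule uniform_limit_theorem)
    show "\<forall>\<^sub>F j in sequentially. continuous_on (cball 0 R) (g (s * int j))"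
      using cont by (intro always_eventually) (metis continuous_on_subset subset_UNIV)
    show "uniform_limit (cball 0 R) (\<lambda>j. g (s * int j)) h sequentially"
    proof (rule uniform_limitI)
      fix \<epsilon> :: real assume "0 < \<epsilon>"
      then obtain N where N: "\<And>n x. N \<le> s * n \<Longrightarrow> norm x \<le> R \<Longrightarrow> norm (g n x - h x) < \<epsilon>"
        using lim by metis
      have ss: "s * (s * int j) = int j" for j using s by auto
      show "\<forall>\<^sub>F j in sequentially. \<forall>x\<in>cball 0 R. dist (g (s * int j) x) (h x) < \<epsilon>"
      proof (intro eventually_sequentiallyI[of "nat N"] ballI)
        fix j and x :: "real^'n" assume "nat N \<le> j" "x \<in> cball 0 R"
        then show "dist (g (s * int j) x) (h x) < \<epsilon>"
          using N[of "s * int j" x] unfolding ss by (simp add: dist_norm nat_le_iff)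
      qed
    qed
  qed simp
  have "z (m + 1) = h (z m)" for m
  proof -
    \<comment> \<open>The original index of position \<open>m\<close> in the translate; it still
      escapes to the end \<open>s\<close> because \<open>m\<close> is fixed.\<close>
    define i where "i j = m + \<nu> (r j)" for j
    have i_top: "filterlim (\<lambda>j. s * i j) at_top sequentially"
      unfolding filterlim_at_top
    proof (intro allI eventually_sequentiallyI)
      fix B :: int and j assume "nat (B + \<bar>m\<bar>) \<le> j"
      then have "B + \<bar>m\<bar> \<le> int (r j)" using seq_suble[OF r, of j] by linarith
      moreover have "- \<bar>m\<bar> \<le> s * m" using s by auto
      ultimately show "B \<le> s * i j" using \<nu>[of "r j"] by (simp add: i_def distrib_left)
    qed
    have \<kappa>_top: "filterlim (\<lambda>j. \<kappa> (r j)) at_top sequentially"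
      by (rule filterlim_at_top_mono[OF r_top]) (use \<kappa> in auto)
    let ?d = "\<lambda>k n. x k (n + 1) - g n (x k n) - y n"
    have "(\<lambda>j. ?d (\<kappa> (r j)) (i j)) \<longlonglongrightarrow> 0"
      by (rule Lim_null_comparison[OF _ filterlim_compose[OF conv \<kappa>_top]])
         (intro always_eventually allI norm_le_l2_norm[OF Gx])
    then have d: "(\<lambda>j. X (r j) (m + 1) - g (i j) (X (r j) m) - y (i j)) \<longlonglongrightarrow> 0"
      by (simp add: X_def i_def algebra_simps)
    have y0: "(\<lambda>j. y (i j)) \<longlonglongrightarrow> 0" by (rule sq_summable_tendsto_0[OF y s i_top])
    have gh: "(\<lambda>j. g (i j) (X (r j) m) - h (X (r j) m)) \<longlonglongrightarrow> 0"
    proof (rule tendstoI)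
      fix \<epsilon> :: real assume "0 < \<epsilon>"
      then obtain N where N: "\<And>n x. N \<le> s * n \<Longrightarrow> norm x \<le> R \<Longrightarrow> norm (g n x - h x) < \<epsilon>"
        using lim by metis
      have "\<forall>\<^sub>F j in sequentially. N \<le> s * i j" using i_top by (simp add: filterlim_at_top)
      then show "\<forall>\<^sub>F j in sequentially. dist (g (i j) (X (r j) m) - h (X (r j) m)) 0 < \<epsilon>"
        by (rule eventually_mono) (use N XR in \<open>auto simp: dist_norm\<close>)
    qed
    have hz: "(\<lambda>j. h (X (r j) m)) \<longlonglongrightarrow> h (z m)"
      by (rule continuous_on_tendsto_compose[OF h_cont z]) (use zR XR in auto)
    \<comment> \<open>The sum telescopes to \<open>X (r j) (m + 1)\<close>: defect, right-hand side
      and distance of \<open>g\<close> from \<open>h\<close> all vanish in the limit.\<close>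
    have "(\<lambda>j. (X (r j) (m + 1) - g (i j) (X (r j) m) - y (i j)) + y (i j)
         + (g (i j) (X (r j) m) - h (X (r j) m)) + h (X (r j) m)) \<longlonglongrightarrow> 0 + 0 + 0 + h (z m)"
      by (intro tendsto_add d y0 gh hz)
    then have "(\<lambda>j. X (r j) (m + 1)) \<longlonglongrightarrow> h (z m)" by simp
    then show ?thesis using z[of "m + 1"] LIMSEQ_unique by blast
  qed
  then have "z = (\<lambda>n. 0)" using sol z_sq by blast
  moreover have "e \<le> norm (z 0)"
    by (rule LIMSEQ_le_const[OF tendsto_norm[OF z]]) (use big in \<open>auto simp: X_def\<close>)
  ultimately show False using e by simp
qed

text \<open>Mean value inequality for \<open>g n - a\<close> on a ball. Its derivative is at most
  \<open>e\<close> there: \<open>e / 2\<close> for moving the base point to 0, uniformly in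
  \<open>n\<close>, and \<open>e / 2\<close> for replacing \<open>Dg n 0\<close> by its
  limit.\<close>

lemma uniformly_close_to_linear:
  fixes g :: "int \<Rightarrow> real^'n \<Rightarrow> real^'n"
  assumes deriv: "\<And>n x. (g n has_derivative (\<lambda>h. Dg n x *v h)) (at x)"
    and equi: "\<And>\<epsilon>. 0 < \<epsilon> \<Longrightarrow> \<exists>\<delta>>0. \<forall>n x. norm x \<le> \<delta> \<longrightarrow> norm (Dg n x - Dg n 0) \<le> \<epsilon>"
    and lim: "\<And>\<epsilon>. 0 < \<epsilon> \<Longrightarrow> \<exists>N. \<forall>n. N \<le> s * n \<longrightarrow> norm (Dg n 0 - a) < \<epsilon>"
    and e: "0 < e"
  obtains \<delta> N where "0 < \<delta>" "\<And>n (p :: real^'n) q. N \<le> s * n \<Longrightarrow> norm p \<le> \<delta> \<Longrightarrow> norm q \<le> \<delta> \<Longrightarrow>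
    norm (g n p - g n q - a *v (p - q)) \<le> e * norm (p - q)"
proof -
  obtain \<delta> where \<delta>: "0 < \<delta>" "\<And>n x. norm x \<le> \<delta> \<Longrightarrow> norm (Dg n x - Dg n 0) \<le> e / 2"
    using equi[of "e / 2"] e by auto
  obtain N where N: "\<And>n. N \<le> s * n \<Longrightarrow> norm (Dg n 0 - a) < e / 2"
    using lim[of "e / 2"] e by auto
  show ?thesis
  proof (rule that[OF \<delta>(1)])
    fix n and p q :: "real^'n" assume n: "N \<le> s * n" and pq: "norm p \<le> \<delta>" "norm q \<le> \<delta>"
    have "norm ((g n p - a *v p) - (g n q - a *v q)) \<le> e * norm (p - q)"
    proof (rule differentiable_bound[where S = "cball 0 \<delta>" and f' = "\<lambda>x h. Dg n x *v h - a *v h"])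
      fix x :: "real^'n" assume x: "x \<in> cball 0 \<delta>"
      show "((\<lambda>x. g n x - a *v x) has_derivative (\<lambda>h. Dg n x *v h - a *v h)) (at x within cball 0 \<delta>)"
        by (intro has_derivative_diff has_derivative_at_withinI[OF deriv]
            bounded_linear_imp_has_derivative matrix_vector_mul_bounded_linear)
      have "norm (Dg n x - a) \<le> e"
        using norm_triangle_ineq[of "Dg n x - Dg n 0" "Dg n 0 - a"] \<delta>(2)[of x n] N[OF n] x by simp
      then show "onorm (\<lambda>h. Dg n x *v h - a *v h) \<le> e"
        unfolding matrix_vector_mult_diff_rdistrib[symmetric]
        by (intro onorm_le order_trans[OF norm_matrix_vector_mult_le] mult_right_mono norm_ge_zero)
    qed (use pq in auto)
    then show "norm (g n p - g n q - a *v (p - q)) \<le> e * norm (p - q)"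
      by (simp add: matrix_vector_mult_diff_distrib algebra_simps)
  qed
qed

text \<open>Cut \<open>x k - z\<close> off to the tail. Applying \<open>S - a\<close> leaves the
  defect, one boundary term and at most \<open>e\<close> times the cut-off sequence; the lower bound
  for \<open>S - a\<close> absorbs the last.\<close>

lemma tail_convergence:
  fixes s :: int and g :: "int \<Rightarrow> real^'n \<Rightarrow> real^'n" and x :: "nat \<Rightarrow> int \<Rightarrow> real^'n"
  assumes s: "s = 1 \<or> s = -1"
    and deriv: "\<And>n x. (g n has_derivative (\<lambda>h. Dg n x *v h)) (at x)"
    and equi: "\<And>\<epsilon>. 0 < \<epsilon> \<Longrightarrow> \<exists>\<delta>>0. \<forall>n x. norm x \<le> \<delta> \<longrightarrow> norm (Dg n x - Dg n 0) \<le> \<epsilon>"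
    and Dlim: "\<And>\<epsilon>. 0 < \<epsilon> \<Longrightarrow> \<exists>N. \<forall>n. N \<le> s * n \<longrightarrow> norm (Dg n 0 - a) < \<epsilon>"
    and hyp: "hyperbolic a"
    and lim: "\<And>R \<epsilon>. 0 < \<epsilon> \<Longrightarrow> \<exists>N. \<forall>n. N \<le> s * n \<longrightarrow> (\<forall>x. norm x \<le> R \<longrightarrow> norm (g n x - h x) < \<epsilon>)"
    and sol: "\<And>z. sq_summable z \<Longrightarrow> (\<forall>n. z (n + 1) = h (z n)) \<Longrightarrow> z = (\<lambda>n. 0)"
    and x: "\<And>k. sq_summable (x k)" "\<And>k. l2_norm (x k) \<le> R"
    and z: "sq_summable z" "\<And>n. (\<lambda>k. x k n) \<longlonglongrightarrow> z n"
    and y: "sq_summable y" "\<And>n. z (n + 1) - g n (z n) = y n"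
    and Gx: "\<And>k. sq_summable (\<lambda>n. x k (n + 1) - g n (x k n) - y n)"
    and conv: "(\<lambda>k. l2_norm (\<lambda>n. x k (n + 1) - g n (x k n) - y n)) \<longlonglongrightarrow> 0"
  shows "\<exists>N. (\<lambda>k. l2_norm (\<lambda>n. if N \<le> s * n then x k n - z n else 0)) \<longlonglongrightarrow> 0"
proof -
  obtain C where C: "0 \<le> C"
    "\<And>v. sq_summable v \<Longrightarrow> l2_norm v \<le> C * l2_norm (\<lambda>n. v (n + 1) - a *v v n)"
    using hyperbolic_difference_operator_bound[OF hyp] by blast
  \<comment> \<open>Chosen to make \<open>C * e\<close> at most one half; adding 1 covers
    \<open>C = 0\<close>.\<close>
  define e where "e = 1 / (2 * (C + 1))"
  have e: "0 < e" "C * e \<le> 1 / 2" using C(1) by (auto simp: e_def field_simps)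
  obtain \<delta> N1 where \<delta>: "0 < \<delta>" and lin: "\<And>n (p :: real^'n) q. N1 \<le> s * n \<Longrightarrow> norm p \<le> \<delta> \<Longrightarrow> norm q \<le> \<delta> \<Longrightarrow>
    norm (g n p - g n q - a *v (p - q)) \<le> e * norm (p - q)"
    by (rule uniformly_close_to_linear[where g = g and Dg = Dg and s = s and a = a and e = e])
       (use deriv equi Dlim e in blast)+
  have cont: "continuous_on UNIV (g n)" for n
    using deriv has_derivative_continuous by (metis continuous_at_imp_continuous_on)
  obtain N2 K where small: "\<And>k n. K \<le> k \<Longrightarrow> N2 \<le> s * n \<Longrightarrow> norm (x k n) < \<delta>"
    using tails_uniformly_small[OF s cont lim sol x y(1) Gx conv \<delta>] by blast
  have small_z: "norm (z n) \<le> \<delta>" if "N2 \<le> s * n" for n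
    by (rule LIMSEQ_le_const2[OF tendsto_norm[OF z(2)]]) (use small that less_imp_le in blast)
  define N where "N = max N1 N2"
  \<comment> \<open>The only index for which exactly one of \<open>b\<close> and
    \<open>b + 1\<close> lies in the tail: \<open>N - 1\<close> at the right end, \<open>- N\<close>
    at the left end.\<close>
  define b where "b = (if s = 1 then N - 1 else - N)"
  have b: "N \<le> s * (n + 1) \<longleftrightarrow> N \<le> s * n" if "n \<noteq> b" for n
    using s that by (auto simp: b_def)
  define v where "v k n = (if N \<le> s * n then x k n - z n else 0)" for k n
  define d where "d k n = x k (n + 1) - g n (x k n) - y n" for k n
  \<comment> \<open>Bounds the boundary term for either sign of \<open>s\<close>. It involves two
    fixed indices, so pointwise convergence sends it to 0.\<close>
  define \<beta> where "\<beta> k = norm (x k (b + 1) - z (b + 1)) + norm a * norm (x k b - z b)" for k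
  define q where "q k n = (if n = b then \<beta> k else 0)" for k n
  have \<beta>0: "0 \<le> \<beta> k" for k by (simp add: \<beta>_def)
  have v: "sq_summable (v k)" for k
    by (rule sq_summable_mono(1)[OF sq_summable_diff(1)[OF x(1)[of k] z(1)], of 1]) (auto simp: v_def)
  have q: "sq_summable (q k)" "l2_norm (q k) \<le> \<beta> k" for k
    using sq_summable_finite_support[of "{b}" "q k"] \<beta>0 by (auto simp: q_def)
  have d: "sq_summable (d k)" for k using Gx by (simp add: d_def[abs_def])
  have bound: "l2_norm (v k) \<le> 2 * C * (l2_norm (d k) + \<beta> k)" if k: "K \<le> k" for k
  proof -
    \<comment> \<open>Merges defect and boundary spike, so that the two-term comparison handles
      three summands.\<close>
    define u where "u n = norm (d k n) + norm (q k n)" for n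
    have u: "sq_summable u" "l2_norm u \<le> 1 * l2_norm (d k) + 1 * l2_norm (q k)"
      using sq_summable_dominated[OF d[of k] q(1)[of k], of 1 1 u] by (auto simp: u_def)
    have "l2_norm (\<lambda>n. v k (n + 1) - a *v v k n) \<le> 1 * l2_norm u + e * l2_norm (v k)"
    proof (rule sq_summable_dominated[OF u(1) v])
      fix n
      show "norm (v k (n + 1) - a *v v k n) \<le> 1 * norm (u n) + e * norm (v k n)"
      proof (cases "n = b")
        case True
        have "norm (v k (b + 1) - a *v v k b) \<le> norm (v k (b + 1)) + norm (a *v v k b)"
          by (rule norm_triangle_ineq4)
        also have "\<dots> \<le> norm (v k (b + 1)) + norm a * norm (v k b)"
          by (simp add: norm_matrix_vector_mult_le)
        also have "\<dots> \<le> \<beta> k" by (auto simp: v_def \<beta>_def)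
        also have "\<dots> \<le> u b" using \<beta>0[of k] by (simp add: u_def q_def)
        finally show ?thesis using True e(1) by (simp add: u_def add_increasing2)
      next
        case False
        show ?thesis
        proof (cases "N \<le> s * n")
          case True
          have "norm (g n (x k n) - g n (z n) - a *v (x k n - z n)) \<le> e * norm (x k n - z n)"
            using True small[OF k, of n] small_z[of n] by (intro lin) (auto simp: N_def)
          \<comment> \<open>Subtract the equation for \<open>z\<close> from the definition of the
            defect.\<close>
          moreover have "v k (n + 1) - a *v v k n
              = d k n + (g n (x k n) - g n (z n) - a *v (x k n - z n))"
            using b[OF False] True by (simp add: v_def d_def flip: y(2))
          ultimately have "norm (v k (n + 1) - a *v v k n) \<le> norm (d k n) + e * norm (x k n - z n)"
            using norm_triangle_ineq[of "d k n" "g n (x k n) - g n (z n) - a *v (x k n - z n)"] by simp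
          then show ?thesis using True False by (simp add: u_def q_def v_def)
        next
          case nJ: False
          then show ?thesis using b[OF False] by (simp add: v_def)
        qed
      qed
    qed (use e in auto)
    then have "l2_norm (\<lambda>n. v k (n + 1) - a *v v k n) \<le> l2_norm (d k) + \<beta> k + e * l2_norm (v k)"
      using u(2) q(2)[of k] by simp
    then have "C * l2_norm (\<lambda>n. v k (n + 1) - a *v v k n) \<le> C * (l2_norm (d k) + \<beta> k + e * l2_norm (v k))"
      using C(1) by (rule mult_left_mono)
    then have "l2_norm (v k) \<le> C * (l2_norm (d k) + \<beta> k) + (C * e) * l2_norm (v k)"
      using C(2)[OF v[of k]] by (simp add: algebra_simps)
    \<comment> \<open>At most half of \<open>l2_norm (v k)\<close> remains on the right and moves to
      the left.\<close>
    also have "\<dots> \<le> C * (l2_norm (d k) + \<beta> k) + 1 / 2 * l2_norm (v k)"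
      using e by (intro add_left_mono mult_right_mono) auto
    finally show ?thesis by simp
  qed
  have xz: "(\<lambda>k. norm (x k n - z n)) \<longlonglongrightarrow> 0" for n
    using z(2)[of n] by (simp add: LIM_zero tendsto_norm_zero)
  have "\<beta> \<longlonglongrightarrow> 0 + norm a * 0"
    unfolding \<beta>_def[abs_def] by (intro tendsto_add tendsto_mult tendsto_const xz)
  then have "(\<lambda>k. 2 * C * (l2_norm (d k) + \<beta> k)) \<longlonglongrightarrow> 2 * C * (0 + 0)"
    using conv by (intro tendsto_mult tendsto_add tendsto_const) (auto simp: d_def[abs_def])
  then have lim0: "(\<lambda>k. 2 * C * (l2_norm (d k) + \<beta> k)) \<longlonglongrightarrow> 0" by simp
  have "(\<lambda>k. l2_norm (v k)) \<longlonglongrightarrow> 0"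
  proof (rule Lim_null_comparison[OF _ lim0])
    show "\<forall>\<^sub>F k in sequentially. norm (l2_norm (v k)) \<le> 2 * C * (l2_norm (d k) + \<beta> k)"
      using bound by (intro eventually_sequentiallyI[of K]) simp
  qed
  then show ?thesis by (auto simp: v_def[abs_def])
qed

section \<open>The metric space \<open>l2\<close> and bounded sets\<close>

lemma l2_eq: "l2 = {x. sq_summable x}"
  by (simp add: l2_def sq_summable_def)

lemma l2_dist_eq: "l2_dist x y = l2_norm (\<lambda>n. x n - y n)"
  by (simp add: l2_dist_def l2_norm_def)

lemma Metric_space_l2: "Metric_space (l2 :: (int \<Rightarrow> real^'n) set) l2_dist"
proof
  fix x y z :: "int \<Rightarrow> real^'n"
  show "0 \<le> l2_dist x y" by (simp add: l2_dist_eq)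
  show "l2_dist x y = l2_dist y x" by (simp add: l2_dist_def norm_minus_commute)
  assume x: "x \<in> l2" and y: "y \<in> l2"
  have xy: "sq_summable (\<lambda>n. x n - y n)" using sq_summable_diff(1) x y by (auto simp: l2_eq)
  show "l2_dist x y = 0 \<longleftrightarrow> x = y"
  proof
    assume "l2_dist x y = 0"
    then have "norm (x n - y n) \<le> 0" for n using norm_le_l2_norm[OF xy, of n] by (simp add: l2_dist_eq)
    then show "x = y" by auto
  qed (simp add: l2_dist_def)
  assume z: "z \<in> l2"
  have yz: "sq_summable (\<lambda>n. y n - z n)" using sq_summable_diff(1) z y by (auto simp: l2_eq)
  show "l2_dist x z \<le> l2_dist x y + l2_dist y z"
    using sq_summable_add(2)[OF xy yz] by (simp add: l2_dist_eq)
qed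

lemma l2_bounded_imp_norm_bound:
  assumes "l2_bounded B"
  obtains R where "\<And>x. x \<in> B \<Longrightarrow> l2_norm x \<le> R"
proof -
  interpret Metric_space l2 l2_dist by (rule Metric_space_l2)
  obtain c r where cr: "B \<subseteq> mcball c r" using assms by (auto simp: l2_bounded_def mbounded_def)
  show ?thesis
  proof (rule that[of "l2_norm c + r"])
    fix x assume "x \<in> B"
    then have x: "x \<in> l2" "c \<in> l2" "l2_dist c x \<le> r" using cr by auto
    then show "l2_norm x \<le> l2_norm c + r"
      using sq_summable_diff(2)[OF _ sq_summable_diff(1)[of c x], of c] by (simp add: l2_eq l2_dist_eq)
  qed
qed

section \<open>Properness at a fixed angle, by sequential compactness\<close>

theorem mainTheorem18:
  fixes f :: "int \<Rightarrow> real \<Rightarrow> real^'d::finite \<Rightarrow> real^'d"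
    and f_lam :: "int \<Rightarrow> real \<Rightarrow> real^'d \<Rightarrow> real^'d"
    and f_x :: "int \<Rightarrow> real \<Rightarrow> real^'d \<Rightarrow> real^'d^'d"
    and a_plus a_minus :: "real \<Rightarrow> real^'d^'d"
    and f_plus f_minus :: "real \<Rightarrow> real^'d \<Rightarrow> real^'d"
  assumes periodic: "\<And>n \<theta> x. f n (\<theta> + 2 * pi) x = f n \<theta> x"
    and deriv: "\<And>n \<theta> x. ((\<lambda>(t, y). f n t y) has_derivative
                   (\<lambda>(s, h). s *\<^sub>R f_lam n \<theta> x + f_x n \<theta> x *v h)) (at (\<theta>, x))"
    and C1_lam: "\<And>n. continuous_on UNIV (\<lambda>(t, y). f_lam n t y)"
    and C1_x: "\<And>n. continuous_on UNIV (\<lambda>(t, y). f_x n t y)"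
    and zero: "\<And>n \<theta>. f n \<theta> 0 = 0"
    and A1: "\<And>M \<epsilon>. M > 0 \<Longrightarrow> \<epsilon> > 0 \<Longrightarrow> \<exists>\<delta>. 0 < \<delta> \<and> \<delta> < M \<and>
               (\<forall>\<theta>1 \<theta>2 x1 x2. norm x1 \<le> M \<and> norm x2 \<le> M \<and> dist (\<theta>1, x1) (\<theta>2, x2) < \<delta> \<longrightarrow>
                  (\<forall>n. norm (f_x n \<theta>1 x1 - f_x n \<theta>2 x2) < \<epsilon> \<and>
                       norm (f_lam n \<theta>1 x1 - f_lam n \<theta>2 x2) < \<epsilon>))"
    and A2_plus: "\<And>\<epsilon>. \<epsilon> > 0 \<Longrightarrow> \<exists>N. \<forall>n \<ge> N. \<forall>\<theta>. norm (f_x n \<theta> 0 - a_plus \<theta>) < \<epsilon>"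
    and A2_minus: "\<And>\<epsilon>. \<epsilon> > 0 \<Longrightarrow> \<exists>N. \<forall>n \<le> N. \<forall>\<theta>. norm (f_x n \<theta> 0 - a_minus \<theta>) < \<epsilon>"
    and A2_hyp: "\<And>\<theta>. hyperbolic (a_plus \<theta>) \<and> hyperbolic (a_minus \<theta>)"
    and A2_index: "\<And>\<theta>. n_stable (a_plus \<theta>) = n_stable (a_minus \<theta>)"
    and A4_plus: "\<And>\<theta> R \<epsilon>. \<epsilon> > 0 \<Longrightarrow> \<exists>N. \<forall>n \<ge> N. \<forall>x. norm x \<le> R \<longrightarrow>
                    norm (f n \<theta> x - f_plus \<theta> x) < \<epsilon>"
    and A4_minus: "\<And>\<theta> R \<epsilon>. \<epsilon> > 0 \<Longrightarrow> \<exists>N. \<forall>n \<le> N. \<forall>x. norm x \<le> R \<longrightarrow>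
                    norm (f n \<theta> x - f_minus \<theta> x) < \<epsilon>"
    and A4_plus_sol: "\<And>\<theta> x. x \<in> l2 \<Longrightarrow> (\<forall>n. x (n + 1) = f_plus \<theta> (x n)) \<Longrightarrow> x = (\<lambda>n. 0)"
    and A4_minus_sol: "\<And>\<theta> x. x \<in> l2 \<Longrightarrow> (\<forall>n. x (n + 1) = f_minus \<theta> (x n)) \<Longrightarrow> x = (\<lambda>n. 0)"
  shows "\<forall>\<theta>. proper_on_closed_bounded (\<lambda>x. (\<lambda>n. x (n + 1) - f n \<theta> (x n)))"
proof
  fix \<theta> :: real
  interpret Metric_space "l2 :: (int \<Rightarrow> real^'d) set" l2_dist by (rule Metric_space_l2)
  have deriv_x: "((f n \<theta>) has_derivative (\<lambda>h. f_x n \<theta> x *v h)) (at x)" for n x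
  proof -
    have "((\<lambda>y. (\<theta>, y)) has_derivative (\<lambda>h. (0, h))) (at x)"
      by (auto intro!: derivative_eq_intros)
    from has_derivative_compose[OF this, of "\<lambda>(t, y). f n t y", OF deriv] show ?thesis by simp
  qed
  have equi: "\<exists>\<delta>>0. \<forall>n x. norm x \<le> \<delta> \<longrightarrow> norm (f_x n \<theta> x - f_x n \<theta> 0) \<le> \<epsilon>" if \<epsilon>: "0 < \<epsilon>" for \<epsilon>
  proof -
    \<comment> \<open>(A1) with \<open>M = 1\<close> and both angles equal to \<theta>; halving
      \<delta> below turns the strict condition into a closed ball.\<close>
    obtain \<delta> where \<delta>: "0 < \<delta>" "\<delta> < 1" and
      *: "\<And>x n. norm x \<le> 1 \<Longrightarrow> dist (\<theta>, x) (\<theta>, 0) < \<delta> \<Longrightarrow> norm (f_x n \<theta> x - f_x n \<theta> 0) < \<epsilon>"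
      using A1[OF zero_less_one \<epsilon>] by (metis norm_zero zero_le_one)
    show ?thesis
    proof (intro exI[of _ "\<delta> / 2"] conjI allI impI)
      fix n and x :: "real^'d" assume "norm x \<le> \<delta> / 2"
      then show "norm (f_x n \<theta> x - f_x n \<theta> 0) \<le> \<epsilon>"
        using \<delta> *[of x n] by (simp add: dist_Pair_Pair)
    qed (use \<delta> in simp)
  qed
  let ?G = "\<lambda>x n. x (n + 1) - f n \<theta> (x n)"
  show "proper_on_closed_bounded ?G"
    unfolding proper_on_closed_bounded_def
  proof (intro allI impI, elim conjE)
    fix B K :: "(int \<Rightarrow> real^'d) set"
    assume B: "closedin l2_top B" "l2_bounded B" and K: "compactin l2_top K"
    obtain R where R: "\<And>x. x \<in> B \<Longrightarrow> l2_norm x \<le> R" using l2_bounded_imp_norm_bound[OF B(2)] by blast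
    have Bl2: "B \<subseteq> l2" using B(1) by (simp add: l2_top_def closedin_metric)
    have Kl2: "K \<subseteq> l2" using K by (simp add: l2_top_def compactin_sequentially)
    show "compactin l2_top {x \<in> B. ?G x \<in> K}"
      unfolding l2_top_def compactin_sequentially
    proof (intro conjI allI impI)
      show "{x \<in> B. ?G x \<in> K} \<subseteq> l2" using Bl2 by blast
      fix \<sigma> :: "nat \<Rightarrow> int \<Rightarrow> real^'d" assume "range \<sigma> \<subseteq> {x \<in> B. ?G x \<in> K}"
      then have \<sigma>: "\<sigma> k \<in> B" "?G (\<sigma> k) \<in> K" for k by auto
      then have "range (\<lambda>k. ?G (\<sigma> k)) \<subseteq> K" by blast
      \<comment> \<open>Compactness of \<open>K\<close> makes the images converge in norm; the
        diagonal subsequence \<open>r2\<close> then makes the arguments converge at each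
        index.\<close>
      then obtain y r1 where y: "y \<in> K" and r1: "strict_mono (r1 :: nat \<Rightarrow> nat)"
        and lim1: "limitin mtopology ((\<lambda>k. ?G (\<sigma> k)) \<circ> r1) y sequentially"
        using K unfolding l2_top_def compactin_sequentially by blast
      have \<sigma>_sq: "sq_summable (\<sigma> k)" for k using \<sigma>(1) Bl2 by (auto simp: l2_eq)
      have "norm (\<sigma> (r1 k) n) \<le> R" for k n
        using norm_le_l2_norm[OF \<sigma>_sq] R[OF \<sigma>(1)] order_trans by blast
      then obtain r2 :: "nat \<Rightarrow> nat" where r2: "strict_mono r2"
        and "\<And>n. n \<in> UNIV \<Longrightarrow> \<exists>l. (\<lambda>k. \<sigma> (r1 (r2 k)) n) \<longlonglongrightarrow> l"
        using function_convergent_subsequence[of UNIV "\<lambda>k. \<sigma> (r1 k)" R] by (metis countableI_type)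
      then obtain z where z: "\<And>n. (\<lambda>k. \<sigma> (r1 (r2 k)) n) \<longlonglongrightarrow> z n" by (metis UNIV_I)
      define x where "x k = \<sigma> (r1 (r2 k))" for k
      have xz: "(\<lambda>k. x k n) \<longlonglongrightarrow> z n" for n using z by (simp add: x_def)
      have x: "x k \<in> B" "?G (x k) \<in> K" "sq_summable (x k)" "l2_norm (x k) \<le> R" for k
        using \<sigma> \<sigma>_sq R by (simp_all add: x_def)
      have z_sq: "sq_summable z" using sq_summable_pointwise_limit(1)[OF xz x(3,4)] .
      have y_sq: "sq_summable y" using y Kl2 by (auto simp: l2_eq)
      have d_sq: "sq_summable (\<lambda>n. ?G (x k) n - y n)" for k
        by (rule sq_summable_diff(1)[OF _ y_sq]) (use x(2) Kl2 in \<open>auto simp: l2_eq\<close>)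
      have "(\<lambda>k. l2_dist (?G (\<sigma> (r1 k))) y) \<longlonglongrightarrow> 0"
        using lim1 by (simp add: limitin_metric_dist_null o_def)
      from LIMSEQ_subseq_LIMSEQ[OF this r2]
      have conv: "(\<lambda>k. l2_norm (\<lambda>n. ?G (x k) n - y n)) \<longlonglongrightarrow> 0"
        by (simp add: o_def x_def l2_dist_eq)
      \<comment> \<open>The images converge at index \<open>n\<close> both to \<open>?G z n\<close>,
        by continuity of \<open>f n \<theta>\<close>, and to \<open>y n\<close>, by norm
        convergence.\<close>
      have Gz: "?G z n = y n" for n
      proof -
        have "isCont (f n \<theta>) (z n)" using deriv_x has_derivative_continuous by blast
        then have "(\<lambda>k. ?G (x k) n) \<longlonglongrightarrow> ?G z n"
          by (rule tendsto_diff[OF xz isCont_tendsto_compose[OF _ xz]])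
        moreover have "(\<lambda>k. ?G (x k) n) \<longlonglongrightarrow> y n"
          by (rule LIM_zero_cancel, rule Lim_null_comparison[OF _ conv])
             (intro always_eventually allI norm_le_l2_norm[OF d_sq])
        ultimately show ?thesis by (rule LIMSEQ_unique)
      qed
      obtain N1 where N1: "(\<lambda>k. l2_norm (\<lambda>n. if N1 \<le> 1 * n then x k n - z n else 0)) \<longlonglongrightarrow> 0"
      proof (rule exE[OF tail_convergence[where s = 1 and g = "\<lambda>n. f n \<theta>" and Dg = "\<lambda>n. f_x n \<theta>"
            and a = "a_plus \<theta>" and h = "f_plus \<theta>" and R = R and x = x and z = z and y = y]])
        show "\<exists>N. \<forall>n. N \<le> 1 * n \<longrightarrow> norm (f_x n \<theta> 0 - a_plus \<theta>) < \<epsilon>" if "0 < \<epsilon>" for \<epsilon>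
          using A2_plus[OF that] by auto
        show "\<exists>N. \<forall>n. N \<le> 1 * n \<longrightarrow> (\<forall>x. norm x \<le> r \<longrightarrow> norm (f n \<theta> x - f_plus \<theta> x) < \<epsilon>)"
          if "0 < \<epsilon>" for r \<epsilon> using A4_plus[OF that] by auto
        show "w = (\<lambda>n. 0)" if "sq_summable w" "\<forall>n. w (n + 1) = f_plus \<theta> (w n)" for w
          using A4_plus_sol that by (auto simp: l2_eq)
      qed (use deriv_x equi A2_hyp x z_sq xz y_sq Gz d_sq conv in auto)
      obtain N2 where N2: "(\<lambda>k. l2_norm (\<lambda>n. if N2 \<le> -1 * n then x k n - z n else 0)) \<longlonglongrightarrow> 0"
      proof (rule exE[OF tail_convergence[where s = "-1" and g = "\<lambda>n. f n \<theta>" and Dg = "\<lambda>n. f_x n \<theta>"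
            and a = "a_minus \<theta>" and h = "f_minus \<theta>" and R = R and x = x and z = z and y = y]])
        \<comment> \<open>At the left end the threshold \<open>N\<close> for \<open>n\<close>
          becomes \<open>- N\<close> for \<open>- n\<close>.\<close>
        have flip: "\<exists>N. \<forall>n. N \<le> -1 * n \<longrightarrow> P n" if "\<exists>N. \<forall>n\<le>N. P n" for P :: "int \<Rightarrow> bool"
        proof -
          obtain N where "\<forall>n\<le>N. P n" using \<open>\<exists>N. \<forall>n\<le>N. P n\<close> by blast
          then show ?thesis by (intro exI[of _ "- N"]) auto
        qed
        show "\<exists>N. \<forall>n. N \<le> -1 * n \<longrightarrow> norm (f_x n \<theta> 0 - a_minus \<theta>) < \<epsilon>" if "0 < \<epsilon>" for \<epsilon>
          by (rule flip[OF A2_minus[OF that, THEN ex_forward]]) auto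
        show "\<exists>N. \<forall>n. N \<le> -1 * n \<longrightarrow> (\<forall>x. norm x \<le> r \<longrightarrow> norm (f n \<theta> x - f_minus \<theta> x) < \<epsilon>)"
          if "0 < \<epsilon>" for r \<epsilon> by (rule flip[OF A4_minus[OF that]])
        show "w = (\<lambda>n. 0)" if "sq_summable w" "\<forall>n. w (n + 1) = f_minus \<theta> (w n)" for w
          using A4_minus_sol that by (auto simp: l2_eq)
      qed (use deriv_x equi A2_hyp x z_sq xz y_sq Gz d_sq conv in auto)
      have "(\<lambda>k. l2_norm (\<lambda>n. x k n - z n)) \<longlonglongrightarrow> 0"
      proof -
        \<comment> \<open>Two tails and this finite window cover the integers; overlaps only enlarge
          the bound. On the window pointwise convergence is enough.\<close>
        define D where "D = {- N2..N1}"
        define u1 where "u1 k n = (if N1 \<le> 1 * n then x k n - z n else 0)" for k n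
        define u2 where "u2 k n = (if N2 \<le> -1 * n then x k n - z n else 0)" for k n
        define u3 where "u3 k n = (if n \<in> D then x k n - z n else 0)" for k n
        have diff: "sq_summable (\<lambda>n. x k n - z n)" for k by (rule sq_summable_diff(1)[OF x(3) z_sq])
        have u12: "sq_summable (u1 k)" "sq_summable (u2 k)" for k
          by (rule sq_summable_mono(1)[OF diff[of k], of 1]; simp add: u1_def u2_def)+
        have u3: "sq_summable (u3 k)" "l2_norm (u3 k) \<le> (\<Sum>n\<in>D. norm (x k n - z n))" for k
        proof -
          have "finite D" by (simp add: D_def)
          from sq_summable_finite_support[OF this, of "u3 k"]
          have "sq_summable (u3 k)" "l2_norm (u3 k) \<le> (\<Sum>n\<in>D. norm (u3 k n))"
            by (auto simp: u3_def)
          moreover have "(\<Sum>n\<in>D. norm (u3 k n)) = (\<Sum>n\<in>D. norm (x k n - z n))"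
            by (rule sum.cong) (auto simp: u3_def)
          ultimately show "sq_summable (u3 k)" "l2_norm (u3 k) \<le> (\<Sum>n\<in>D. norm (x k n - z n))"
            by simp_all
        qed
        have le: "l2_norm (\<lambda>n. x k n - z n) \<le> l2_norm (u1 k) + l2_norm (u2 k) + (\<Sum>n\<in>D. norm (x k n - z n))"
          for k
        proof -
          define w where "w n = norm (u1 k n) + norm (u2 k n)" for n
          have w: "sq_summable w" "l2_norm w \<le> 1 * l2_norm (u1 k) + 1 * l2_norm (u2 k)"
            using sq_summable_dominated[OF u12(1)[of k] u12(2)[of k], of 1 1 w] by (auto simp: w_def)
          have "l2_norm (\<lambda>n. x k n - z n) \<le> 1 * l2_norm w + 1 * l2_norm (u3 k)"
          proof (rule sq_summable_dominated[OF w(1) u3(1)])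
            fix n
            have "N1 \<le> 1 * n \<or> N2 \<le> -1 * n \<or> n \<in> D" by (auto simp: D_def)
            then show "norm (x k n - z n) \<le> 1 * norm (w n) + 1 * norm (u3 k n)"
              by (auto simp: w_def u1_def u2_def u3_def)
          qed auto
          then show ?thesis using w(2) u3(2)[of k] by simp
        qed
        have "(\<lambda>k. \<Sum>n\<in>D. norm (x k n - z n)) \<longlonglongrightarrow> (\<Sum>n\<in>D. 0)"
          by (intro tendsto_sum tendsto_norm_zero LIM_zero xz)
        then have "(\<lambda>k. l2_norm (u1 k) + l2_norm (u2 k) + (\<Sum>n\<in>D. norm (x k n - z n))) \<longlonglongrightarrow> 0 + 0 + 0"
          using N1 N2 unfolding u1_def[abs_def] u2_def[abs_def] by (intro tendsto_add) auto
        then have lim0: "(\<lambda>k. l2_norm (u1 k) + l2_norm (u2 k) + (\<Sum>n\<in>D. norm (x k n - z n))) \<longlonglongrightarrow> 0"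
          by simp
        show ?thesis
          by (rule Lim_null_comparison[OF _ lim0]) (simp add: le)
      qed
      then have lim: "limitin mtopology x z sequentially"
        unfolding limitin_metric_dist_null l2_dist_eq using x(3) z_sq by (simp add: l2_eq)
      \<comment> \<open>Norm convergence, unlike pointwise convergence, keeps the limit in the
        closed set \<open>B\<close>.\<close>
      have "z \<in> B"
        using B(1) lim x(1) unfolding l2_top_def metric_closedin_iff_sequentially_closed by blast
      moreover have "?G z = y" using Gz by auto
      moreover have "x = \<sigma> \<circ> (r1 \<circ> r2)" by (auto simp: x_def)
      ultimately show "\<exists>l r. l \<in> {x \<in> B. ?G x \<in> K} \<and> strict_mono r \<and>
          limitin mtopology (\<sigma> \<circ> r) l sequentially"
        using lim y strict_mono_o[OF r1 r2] by blast
    qed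
  qed
qed

end
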